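(* Let $p_1,\ldots,p_n$ be relatively prime positive integers, let $p=(p_1,\ldots,p_n)$, and let $G$ be a Gröbner basis of the lattice ideal $I_{\mathcal L}$ with respect to the term order $\leq$ defined in the context. Let $M_p$ be the set of all vectors $c\in\mathbb{Z}^n$ such that (M1) $c_1=-1$ and $c_i\geq 0$ for $i=2,\ldots,n$; (M2) $x^{c^+}$ cannot be reduced by any element of $G$; (M3) for each $i=2,\ldots,n$, $x^{(c+e_i)^+}$ can be reduced by some $g_i\in G$. Then the following hold. (i) $M_p$ is finite. (ii) If $a\in M_p$ then $a\cdot p$ is not $p$-representable. (iii) $f^*_p=\max\{a\cdot p \mid a\in M_p\}$, where $f^*_p$ is the Frobenius number of $p$.
   Context: $\mathbb{N}$ includes $0$. "Relatively prime" means $\gcd(p_1,\ldots,p_n)=1$ (not necessarily pairwise coprime). An integer $t$ is $p$-representable if $t=v\cdot p$ for some $v\in\mathbb{N}^n$. The Frobenius number $f^*_p$ is the largest integer that is not $p$-representable (it exists; note negative integers are not $p$-representable). The $p$-degree of $v\in\mathbb{Z}^n$ is $v\cdot p$. $e_i\in\mathbb{N}^n$ is the $i$-th standard basis vector. For $v\in\mathbb{Z}^n$, $v^+\in\mathbb{N}^n$ is given by $v^+_i=\max(v_i,0)$ and $v^-:=(-v)^+$. For $v\in\mathbb{N}^n$, $x^v=x_1^{v_1}\cdots x_n^{v_n}$ in the polynomial ring $k[x_1,\ldots,x_n]$ over a field $k$. The lattice ideal is $I_{\mathcal L}=\langle x^{v^+}-x^{v^-} \mid v\in\mathbb{Z}^n,\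 v\cdot p=0\rangle$. The term order $\leq$ first compares the $p$-degree of exponent vectors, and breaks ties by the reverse lexicographic order with $x_1<x_2<\cdots<x_n$: if $u\ne v$ have equal $p$-degree, then $x^u<x^v$ iff $u_i>v_i$ for the smallest index $i$ with $u_i\neq v_i$. A monomial $x^m$ can be reduced by $g$ if the initial monomial $\mathrm{in}_\leq(g)$ divides $x^m$. *)

theory Defs
  imports "HOL-Analysis.Finite_Cartesian_Product" "HOL-Library.Poly_Mapping"
begin

text \<open>
  The index set of the variables is a finite linearly ordered type \<open>'n\<close>, standing for
  \<open>1 < 2 < \<dots> < n\<close>; the first index is \<open>Min UNIV\<close>. Exponent vectors have type \<open>(nat, 'n) vec\<close>, and
  \<open>(nat, 'n) vec \<Rightarrow>\<^sub>0 'k\<close>, with the convolution product of \<open>Poly_Mapping\<close>, is the polynomial ring over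
  \<open>'k\<close> in these variables.
\<close>

type_synonym ('k, 'n) mpoly = "(nat, 'n) vec \<Rightarrow>\<^sub>0 'k"

definition xpow :: "(nat, 'n::finite) vec \<Rightarrow> ('k::field, 'n) mpoly"
  where "xpow v = Poly_Mapping.single v 1"

text \<open>Polymorphic in the entries, so that it applies to vectors over both \<open>nat\<close> and \<open>int\<close>.\<close>

definition pdeg :: "(nat, 'n::finite) vec \<Rightarrow> ('a::comm_semiring_1, 'n) vec \<Rightarrow> 'a"
  where "pdeg p v = (\<Sum>i\<in>UNIV. v $ i * of_nat (p $ i))"

definition representable :: "(nat, 'n::finite) vec \<Rightarrow> int \<Rightarrow> bool"
  where "representable p t \<longleftrightarrow> (\<exists>v :: (nat, 'n) vec. t = int (pdeg p v))"

definition frobenius_number :: "(nat, 'n::finite) vec \<Rightarrow> int"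
  where "frobenius_number p = (GREATEST t. \<not> representable p t)"

definition pos_part :: "(int, 'n::finite) vec \<Rightarrow> (nat, 'n) vec"
  where "pos_part v = (\<chi> i. nat (max (v $ i) 0))"

definition neg_part :: "(int, 'n::finite) vec \<Rightarrow> (nat, 'n) vec"
  where "neg_part v = pos_part (- v)"

text \<open>An ideal of a commutative ring is a submodule of the ring regarded as a module over itself.\<close>

lemma module_times: "module ((*) :: 'a::comm_ring_1 \<Rightarrow> 'a \<Rightarrow> 'a)"
  by unfold_locales (simp_all add: algebra_simps)

definition ideal_generated :: "'a::comm_ring_1 set \<Rightarrow> 'a set"
  where "ideal_generated S = module.span (*) S"

definition lattice_ideal :: "(nat, 'n::finite) vec \<Rightarrow> ('k::field, 'n) mpoly set"
  where "lattice_ideal p =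
    ideal_generated {xpow (pos_part v) - xpow (neg_part v) | v :: (int, 'n) vec. pdeg p v = 0}"

definition term_less :: "(nat, 'n::{finite,linorder}) vec \<Rightarrow> (nat, 'n) vec \<Rightarrow> (nat, 'n) vec \<Rightarrow> bool"
  where "term_less p u v \<longleftrightarrow>
    pdeg p u < pdeg p v \<or>
    pdeg p u = pdeg p v \<and> (\<exists>i. u $ i > v $ i \<and> (\<forall>j<i. u $ j = v $ j))"

definition lead_exp :: "(nat, 'n::{finite,linorder}) vec \<Rightarrow> ('k::field, 'n) mpoly \<Rightarrow> (nat, 'n) vec"
  where "lead_exp p f =
    (THE u. u \<in> Poly_Mapping.keys f \<and> (\<forall>v\<in>Poly_Mapping.keys f. v \<noteq> u \<longrightarrow> term_less p v u))"

text \<open>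
  The initial monomial is taken without its coefficient. The initial monomial of \<open>0\<close> is \<open>0\<close>, which
  divides no monomial, so a zero element of a Groebner basis plays no role.
\<close>

definition init_monomial :: "(nat, 'n::{finite,linorder}) vec \<Rightarrow> ('k::field, 'n) mpoly \<Rightarrow> ('k, 'n) mpoly"
  where "init_monomial p f = (if f = 0 then 0 else xpow (lead_exp p f))"

definition is_groebner_basis ::
    "(nat, 'n::{finite,linorder}) vec \<Rightarrow> ('k::field, 'n) mpoly set \<Rightarrow> ('k, 'n) mpoly set \<Rightarrow> bool"
  where "is_groebner_basis p G I \<longleftrightarrow>
    finite G \<and> G \<subseteq> I \<and>
    ideal_generated (init_monomial p ` G) = ideal_generated (init_monomial p ` I)"

definition reducible_by ::
    "(nat, 'n::{finite,linorder}) vec \<Rightarrow> (nat, 'n) vec \<Rightarrow> ('k::field, 'n) mpoly \<Rightarrow> bool"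
  where "reducible_by p m g \<longleftrightarrow> init_monomial p g dvd xpow m"

definition M_set ::
    "(nat, 'n::{finite,linorder}) vec \<Rightarrow> ('k::field, 'n) mpoly set \<Rightarrow> (int, 'n) vec set"
  where "M_set p G =
    {c. c $ Min UNIV = -1 \<and> (\<forall>i. i \<noteq> Min UNIV \<longrightarrow> c $ i \<ge> 0) \<and>
        (\<forall>g\<in>G. \<not> reducible_by p (pos_part c) g) \<and>
        (\<forall>i. i \<noteq> Min UNIV \<longrightarrow> (\<exists>g\<in>G. reducible_by p (pos_part (c + axis i 1)) g))}"

end

theory Submission
  imports Defs "HOL-Computational_Algebra.Group_Closure"
begin

text \<open>
  A monomial \<open>x\<^sup>m\<close> can be reduced by \<open>G\<close> iff \<open>m\<close> is not the least vector of its \<open>p\<close>-degree: a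
  binomial \<open>x\<^sup>m - x\<^sup>u\<close> with \<open>u\<close> of the same degree lies in the lattice ideal, and conversely the
  coefficients of an element of the lattice ideal sum to zero in every \<open>p\<close>-degree, so its leading
  monomial is accompanied by a smaller one of the same degree. The least vector of a degree has the
  largest possible first entry. Hence, for \<open>m\<close> with first entry \<open>0\<close>, irreducibility of \<open>m\<close> makes
  \<open>m \<cdot> p - p\<^sub>1\<close> non-representable, while representability of \<open>m \<cdot> p - p\<^sub>1\<close> makes \<open>m\<close> reducible. Applied
  to the least vector of degree \<open>f + p\<^sub>1\<close>, \<open>f\<close> the Frobenius number, this gives an element of \<open>M\<^sub>p\<close>
  of degree \<open>f\<close>.
\<close>

subsection \<open>Degrees\<close>

lemma pdeg_add: "pdeg p (u + v) = pdeg p u + pdeg p v"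
  by (simp add: pdeg_def sum.distrib distrib_right)

lemma pdeg_axis: "pdeg p (axis i 1) = of_nat (p $ i)"
  by (simp add: pdeg_def axis_def if_distrib[of "\<lambda>x. x * _"] cong: if_cong)

lemma of_nat_pdeg: "of_nat (pdeg p v) = pdeg p (\<chi> i. of_nat (v $ i))"
  by (simp add: pdeg_def)

lemma pdeg_pos_part_neg_part:
  "int (pdeg p (pos_part v)) - int (pdeg p (neg_part v)) = pdeg p v"
proof -
  have "int (pdeg p (pos_part v)) - int (pdeg p (neg_part v)) =
    (\<Sum>i\<in>UNIV. (int (pos_part v $ i) - int (neg_part v $ i)) * int (p $ i))"
    by (simp add: pdeg_def sum_subtractf left_diff_distrib)
  also have "\<dots> = pdeg p v"
    unfolding pdeg_def by (intro sum.cong) (auto simp: pos_part_def neg_part_def max_def)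
  finally show ?thesis .
qed

lemma component_le_pdeg:
  fixes v :: "(nat, 'n::finite) vec"
  assumes "\<And>i. p $ i > 0"
  shows "v $ i \<le> pdeg p v"
proof -
  have "v $ i \<le> v $ i * p $ i" using assms[of i] by simp
  also have "\<dots> \<le> pdeg p v"
    using member_le_sum[of i UNIV "\<lambda>i. v $ i * p $ i"] by (simp add: pdeg_def)
  finally show ?thesis .
qed

text \<open>Positive weights bound every entry of \<open>v\<close> by \<open>d\<close>. This
  finiteness yields least vectors in a degree, makes sums over one degree finite sums, and later
  bounds \<open>M_set p G\<close>.\<close>

lemma finite_pdeg_le:
  assumes "\<And>i. p $ i > 0"
  shows "finite {v :: (nat, 'n::finite) vec. pdeg p v \<le> d}"
proof -
  have "finite (vec_lambda ` ((UNIV :: 'n set) \<rightarrow>\<^sub>E {..d}))"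
    by (intro finite_imageI finite_PiE) auto
  moreover have "{v :: (nat, 'n) vec. pdeg p v \<le> d} \<subseteq> vec_lambda ` (UNIV \<rightarrow>\<^sub>E {..d})"
  proof
    fix v :: "(nat, 'n) vec" assume "v \<in> {v. pdeg p v \<le> d}"
    then have "vec_nth v \<in> UNIV \<rightarrow>\<^sub>E {..d}"
      using component_le_pdeg[OF assms, of v] by (auto intro: order_trans)
    then show "v \<in> vec_lambda ` (UNIV \<rightarrow>\<^sub>E {..d})"
      by (intro image_eqI[of _ _ "vec_nth v"]) simp_all
  qed
  ultimately show ?thesis by (rule finite_subset[rotated])
qed

lemma finite_pdeg_eq:
  assumes "\<And>i. p $ i > 0"
  shows "finite {v :: (nat, 'n::finite) vec. pdeg p v = d}"
  by (rule finite_subset[OF _ finite_pdeg_le[OF assms, where d = d]]) auto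

subsection \<open>The term order\<close>

lemma term_less_irrefl: "\<not> term_less p u u"
  by (simp add: term_less_def)

lemma term_less_trans:
  assumes "term_less p u v" "term_less p v w"
  shows "term_less p u w"
proof (cases "pdeg p u = pdeg p v \<and> pdeg p v = pdeg p w")
  case True
  then obtain i j where i: "u $ i > v $ i" "\<forall>k<i. u $ k = v $ k"
    and j: "v $ j > w $ j" "\<forall>k<j. v $ k = w $ k"
    using assms by (auto simp: term_less_def)
  have "u $ min i j > w $ min i j" "\<forall>k<min i j. u $ k = w $ k"
    using i j by (cases i j rule: linorder_cases; auto simp: min_def)+
  moreover have "pdeg p u = pdeg p w" using True by simp
  ultimately show ?thesis unfolding term_less_def by blast
qed (use assms in \<open>auto simp: term_less_def\<close>)

lemma term_less_total:
  assumes "u \<noteq> v"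
  shows "term_less p u v \<or> term_less p v u"
proof -
  \<comment> \<open>The least index of disagreement decides a tie between equal degrees.\<close>
  define A where "A = {i. u $ i \<noteq> v $ i}"
  have "finite A" "A \<noteq> {}" using assms by (auto simp: A_def vec_eq_iff)
  then have "Min A \<in> A" "\<forall>j<Min A. j \<notin> A" by (auto dest: Min_le)
  then obtain i where "u $ i \<noteq> v $ i" "\<forall>j<i. u $ j = v $ j"
    unfolding A_def by blast
  then show ?thesis
    unfolding term_less_def by (metis nat_neq_iff)
qed

lemma term_less_add_right: "term_less p u v \<Longrightarrow> term_less p (u + w) (v + w)"
  by (auto simp: term_less_def pdeg_add)

lemma transp_term_less: "transp_on A (term_less p)"
  by (rule transp_onI) (rule term_less_trans)

lemma totalp_term_less: "totalp_on A (term_less p)"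
  by (rule totalp_onI) (rule term_less_total)

lemma ex_term_least:
  assumes "finite A" "A \<noteq> {}"
  shows "\<exists>u\<in>A. \<forall>v\<in>A. v \<noteq> u \<longrightarrow> term_less p u v"
  by (rule Finite_Set.bex_least_element[OF assms transp_term_less totalp_term_less])

lemma ex_term_greatest:
  assumes "finite A" "A \<noteq> {}"
  shows "\<exists>u\<in>A. \<forall>v\<in>A. v \<noteq> u \<longrightarrow> term_less p v u"
  by (rule Finite_Set.bex_greatest_element[OF assms transp_term_less totalp_term_less])

lemma lead_exp_eqI:
  assumes "u \<in> Poly_Mapping.keys f"
    and "\<And>v. v \<in> Poly_Mapping.keys f \<Longrightarrow> v \<noteq> u \<Longrightarrow> term_less p v u"
  shows "lead_exp p f = u"
  unfolding lead_exp_def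
proof (rule the_equality)
  fix w assume "w \<in> Poly_Mapping.keys f \<and>
    (\<forall>v\<in>Poly_Mapping.keys f. v \<noteq> w \<longrightarrow> term_less p v w)"
  then show "w = u" using assms by (metis term_less_irrefl term_less_trans)
qed (use assms in blast)

lemma lead_exp_greatest:
  assumes "f \<noteq> 0"
  shows "lead_exp p f \<in> Poly_Mapping.keys f"
    and "\<And>v. v \<in> Poly_Mapping.keys f \<Longrightarrow> v \<noteq> lead_exp p f \<Longrightarrow> term_less p v (lead_exp p f)"
proof -
  obtain u where "u \<in> Poly_Mapping.keys f"
    "\<And>v. v \<in> Poly_Mapping.keys f \<Longrightarrow> v \<noteq> u \<Longrightarrow> term_less p v u"
    using ex_term_greatest[of "Poly_Mapping.keys f" p] assms by auto
  moreover from this have "lead_exp p f = u" by (rule lead_exp_eqI)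
  ultimately show "lead_exp p f \<in> Poly_Mapping.keys f"
    "\<And>v. v \<in> Poly_Mapping.keys f \<Longrightarrow> v \<noteq> lead_exp p f \<Longrightarrow> term_less p v (lead_exp p f)"
    by auto
qed

subsection \<open>Monomial ideals and the lattice ideal\<close>

lemma xpow_add: "xpow (u + v) = (xpow u * xpow v :: ('k::field, 'n::finite) mpoly)"
  by (simp add: xpow_def mult_single)

lemma keys_xpow_mult:
  assumes "w \<in> Poly_Mapping.keys (c * (xpow u :: ('k::field, 'n::finite) mpoly))"
  obtains r where "w = u + r"
proof -
  have "w \<in> {a + b | a b. a \<in> Poly_Mapping.keys c \<and>
      b \<in> Poly_Mapping.keys (xpow u :: ('k, 'n) mpoly)}"
    using keys_mult assms by blast
  then obtain a where "w = a + u" by (auto simp: xpow_def)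
  then show thesis using that[of a] by (simp add: add.commute)
qed

lemma xpow_dvd_xpow_iff:
  "(xpow u :: ('k::field, 'n::finite) mpoly) dvd xpow v \<longleftrightarrow> (\<exists>r. v = u + r)"
proof
  assume "(xpow u :: ('k, 'n) mpoly) dvd xpow v"
  then obtain c :: "('k, 'n) mpoly" where c: "xpow v = xpow u * c" ..
  have "v \<in> Poly_Mapping.keys (xpow v :: ('k, 'n) mpoly)" by (simp add: xpow_def)
  then have "v \<in> Poly_Mapping.keys (c * xpow u)" by (simp only: c mult.commute)
  then show "\<exists>r. v = u + r" by (rule keys_xpow_mult) blast
qed (auto simp: xpow_add)

lemma keys_ideal_generated_monomials:
  fixes f :: "('k::field, 'n::finite) mpoly"
  assumes f: "f \<in> ideal_generated S" and S: "S \<subseteq> insert 0 (range xpow)"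
    and m: "m \<in> Poly_Mapping.keys f"
  shows "\<exists>s\<in>S. s dvd xpow m"
proof -
  have "\<forall>m\<in>Poly_Mapping.keys f. \<exists>s\<in>S. s dvd xpow m"
    using f unfolding ideal_generated_def
  proof (induction rule: module.span_induct_alt[OF module_times, consumes 1, case_names base step])
    case (step c x y)
    have "\<exists>s\<in>S. s dvd xpow m" if "m \<in> Poly_Mapping.keys (c * x)" for m
    proof -
      have "x \<noteq> 0" using that by auto
      moreover have "x \<in> insert 0 (range xpow)" using step S by blast
      ultimately obtain u where u: "x = xpow u" by blast
      with that obtain r where "m = u + r" by (metis keys_xpow_mult)
      with u step show ?thesis using xpow_dvd_xpow_iff by blast
    qed
    then show ?case using step.IH keys_add[of "c * x" y] by blast
  qed simp
  with m show ?thesis by blast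
qed

lemma ideal_generated_base: "x \<in> S \<Longrightarrow> x \<in> ideal_generated S"
  unfolding ideal_generated_def by (rule module.span_base[OF module_times])

lemma ideal_generated_mult: "x \<in> ideal_generated S \<Longrightarrow> c * x \<in> ideal_generated S"
  unfolding ideal_generated_def by (rule module.span_scale[OF module_times])

lemma binomial_in_lattice_ideal:
  assumes "pdeg p u = pdeg p v"
  shows "xpow u - xpow v \<in> (lattice_ideal p :: ('k::field, 'n::finite) mpoly set)"
proof -
  \<comment> \<open>Pulling the common factor \<open>xpow w\<close> out of the binomial leaves the
    lattice generator of \<open>d\<close>.\<close>
  define d :: "(int, 'n) vec" where "d = (\<chi> i. int (u $ i) - int (v $ i))"
  define w :: "(nat, 'n) vec" where "w = (\<chi> i. min (u $ i) (v $ i))"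
  have "pdeg p d = int (pdeg p u) - int (pdeg p v)"
    by (simp add: d_def pdeg_def left_diff_distrib sum_subtractf)
  then have "xpow (pos_part d) - xpow (neg_part d) \<in> (lattice_ideal p :: ('k, 'n) mpoly set)"
    using assms unfolding lattice_ideal_def by (intro ideal_generated_base) auto
  then have "xpow w * (xpow (pos_part d) - xpow (neg_part d)) \<in> (lattice_ideal p :: ('k, 'n) mpoly set)"
    unfolding lattice_ideal_def by (rule ideal_generated_mult)
  moreover have "w + pos_part d = u" "w + neg_part d = v"
    by (auto simp: vec_eq_iff w_def d_def pos_part_def neg_part_def min_def max_def)
  ultimately show ?thesis
    by (metis xpow_add right_diff_distrib)
qed

text \<open>The sum is additive in \<open>f\<close>, so it suffices to treat a single term times a
  generator. Such a term shifts both exponents of the binomial by the same vector, so they keep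
  equal degrees and their coefficients cancel.\<close>

lemma lattice_ideal_coefficient_sum:
  fixes f :: "('k::field, 'n::finite) mpoly"
  assumes p: "\<And>i. p $ i > 0" and f: "f \<in> lattice_ideal p"
  shows "(\<Sum>v | pdeg p v = d. Poly_Mapping.lookup f v) = 0"
proof -
  define \<phi> where "\<phi> f = (\<Sum>v | pdeg p v = d. Poly_Mapping.lookup f v)" for f :: "('k, 'n) mpoly"
  have \<phi>_add: "\<phi> (f + g) = \<phi> f + \<phi> g" and \<phi>_diff: "\<phi> (f - g) = \<phi> f - \<phi> g" for f g
    by (simp_all add: \<phi>_def lookup_add lookup_minus sum.distrib sum_subtractf)
  have \<phi>_single: "\<phi> (Poly_Mapping.single v c) = (if pdeg p v = d then c else 0)" for v c
    using finite_pdeg_eq[of p d, OF p] by (simp add: \<phi>_def lookup_single when_def)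
  have \<phi>_mult: "\<phi> (c * (xpow u - xpow v)) = 0" if "pdeg p u = pdeg p v" for c u v
  proof (induction c rule: update_induct)
    case const
    show ?case by (simp add: \<phi>_def)
  next
    case (update c a b)
    have "Poly_Mapping.update a b c = c + Poly_Mapping.single a b"
      using update by (intro poly_mapping_eqI)
        (auto simp: lookup_update lookup_add lookup_single when_def in_keys_iff)
    moreover have "\<phi> (Poly_Mapping.single a b * (xpow u - xpow v)) = 0"
      using that by (simp add: right_diff_distrib xpow_def mult_single \<phi>_diff \<phi>_single pdeg_add)
    ultimately show ?case using update by (simp add: distrib_right \<phi>_add)
  qed
  have "\<phi> f = 0"
    using f unfolding lattice_ideal_def ideal_generated_def
  proof (induction rule: module.span_induct_alt[OF module_times, consumes 1, case_names base step])
    case base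
    show ?case by (simp add: \<phi>_def)
  next
    case (step c x y)
    then obtain v :: "(int, 'n) vec" where v: "pdeg p v = 0"
      and x: "x = xpow (pos_part v) - xpow (neg_part v)" by auto
    have "pdeg p (pos_part v) = pdeg p (neg_part v)"
      using pdeg_pos_part_neg_part[of p v] v by simp
    with \<phi>_mult step show ?case by (simp add: \<phi>_add x)
  qed
  then show ?thesis by (simp add: \<phi>_def)
qed

text \<open>This removes \<open>G\<close> from the problem: reducibility depends only on the weights
  and the term order.\<close>

lemma groebner_reducible_iff:
  fixes G :: "('k::field, 'n::{finite,linorder}) mpoly set"
  assumes p: "\<And>i. p $ i > 0" and G: "is_groebner_basis p G (lattice_ideal p)"
  shows "(\<exists>g\<in>G. reducible_by p m g) \<longleftrightarrow> (\<exists>u. pdeg p u = pdeg p m \<and> term_less p u m)"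
proof
  assume "\<exists>g\<in>G. reducible_by p m g"
  then obtain g where g: "g \<in> G" "init_monomial p g dvd xpow m"
    by (auto simp: reducible_by_def)
  have "g \<noteq> 0"
  proof
    assume "g = 0"
    with g have "(xpow m :: ('k, 'n) mpoly) = 0" by (simp add: init_monomial_def)
    then have "Poly_Mapping.lookup (xpow m :: ('k, 'n) mpoly) m = 0" by simp
    then show False by (simp add: xpow_def)
  qed
  define w where "w = lead_exp p g"
  have "(xpow w :: ('k, 'n) mpoly) dvd xpow m"
    using g \<open>g \<noteq> 0\<close> by (simp add: init_monomial_def w_def)
  then obtain r where r: "m = w + r" using xpow_dvd_xpow_iff by blast
  have "g \<in> lattice_ideal p" using g G by (auto simp: is_groebner_basis_def)
  then have "(\<Sum>v | pdeg p v = pdeg p w. Poly_Mapping.lookup g v) = 0"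
    by (rule lattice_ideal_coefficient_sum[OF p])
  moreover have "Poly_Mapping.lookup g w \<noteq> 0"
    using lead_exp_greatest(1)[OF \<open>g \<noteq> 0\<close>, of p] by (simp add: w_def in_keys_iff)
  \<comment> \<open>The nonzero coefficient at \<open>w\<close> must be cancelled by others of its
    degree, whose exponents lie below the leading one. Adding \<open>r\<close> then carries the
    comparison from \<open>w\<close> to \<open>m\<close>.\<close>
  ultimately have "(\<Sum>v\<in>{v. pdeg p v = pdeg p w} - {w}. Poly_Mapping.lookup g v) \<noteq> 0"
    using sum.remove[OF finite_pdeg_eq[of p "pdeg p w", OF p], of w "Poly_Mapping.lookup g"] by auto
  then obtain u where u: "pdeg p u = pdeg p w" "u \<noteq> w" "u \<in> Poly_Mapping.keys g"
    by (metis (mono_tags, lifting) DiffE in_keys_iff insertI1 mem_Collect_eq sum.neutral)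
  then have "term_less p u w"
    using lead_exp_greatest(2)[OF \<open>g \<noteq> 0\<close>] by (simp add: w_def)
  then show "\<exists>u. pdeg p u = pdeg p m \<and> term_less p u m"
    using u r term_less_add_right pdeg_add by metis
next
  assume "\<exists>u. pdeg p u = pdeg p m \<and> term_less p u m"
  then obtain u where u: "pdeg p u = pdeg p m" "term_less p u m" by blast
  then have "u \<noteq> m" using term_less_irrefl by blast
  define f :: "('k, 'n) mpoly" where "f = xpow m - xpow u"
  have f: "f \<in> lattice_ideal p"
    unfolding f_def by (rule binomial_in_lattice_ideal) (simp add: u)
  have lookup_f: "Poly_Mapping.lookup f v = (1 when m = v) - (1 when u = v)" for v
    by (simp add: f_def xpow_def lookup_minus lookup_single)
  have "m \<in> Poly_Mapping.keys f"
    using \<open>u \<noteq> m\<close> by (simp add: in_keys_iff lookup_f)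
  moreover have "v = u" if "v \<in> Poly_Mapping.keys f" "v \<noteq> m" for v
    using that by (auto simp: in_keys_iff lookup_f when_def split: if_splits)
  ultimately have "lead_exp p f = m" "f \<noteq> 0"
    using u by (auto intro!: lead_exp_eqI)
  then have "xpow m = init_monomial p f" by (simp add: init_monomial_def)
  then have "(xpow m :: ('k, 'n) mpoly) \<in> ideal_generated (init_monomial p ` lattice_ideal p)"
    using f by (intro ideal_generated_base) auto
  then have "(xpow m :: ('k, 'n) mpoly) \<in> ideal_generated (init_monomial p ` G)"
    using G by (simp add: is_groebner_basis_def)
  moreover have "init_monomial p ` G \<subseteq> insert 0 (range xpow)"
    by (auto simp: init_monomial_def)
  ultimately have "\<exists>s\<in>init_monomial p ` G. s dvd xpow m"
    by (rule keys_ideal_generated_monomials) (simp add: xpow_def)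
  then show "\<exists>g\<in>G. reducible_by p m g"
    by (auto simp: reducible_by_def)
qed

subsection \<open>The Frobenius number\<close>

text \<open>Bezout's identity: the values of \<open>pdeg p\<close> on integer vectors form a
  subgroup containing all weights, hence also their gcd.\<close>

lemma ex_pdeg_eq_Gcd: "\<exists>z. pdeg p z = int (Gcd (range (\<lambda>i. p $ i)))"
proof -
  have "\<exists>z. pdeg p z = t" if "t \<in> group_closure (int ` range (\<lambda>i. p $ i))" for t
    using that
  proof induction
    case (base t)
    \<comment> \<open>The base case of \<open>group_closure\<close> covers 0 besides the
      generators.\<close>
    have "pdeg p 0 = (0::int)" by (simp add: pdeg_def)
    with base show ?case by (auto intro: pdeg_axis)
  next
    case (diff s t)
    then obtain y z where "pdeg p y = s" "pdeg p z = t" by blast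
    then have "pdeg p (y - z) = s - t"
      by (simp add: pdeg_def left_diff_distrib sum_subtractf flip: \<open>pdeg p y = s\<close>)
    then show ?case ..
  qed
  then show ?thesis
    using Gcd_in_group_closure[of "int ` range (\<lambda>i. p $ i)"] by (simp only: Gcd_int_eq)
qed

lemma representableI:
  assumes "\<And>i. z $ i \<ge> 0"
  shows "representable p (pdeg p z)"
proof -
  have "pdeg p z = int (pdeg p (\<chi> i. nat (z $ i)))"
    using assms by (simp add: pdeg_def)
  then show ?thesis unfolding representable_def ..
qed

lemma eventually_representable:
  fixes p :: "(nat, 'n::finite) vec"
  assumes p: "\<And>i. p $ i > 0" and gcd: "Gcd (range (\<lambda>i. p $ i)) = 1"
  shows "\<exists>B. \<forall>t\<ge>B. representable p t"
proof -
  obtain y where y: "pdeg p y = (1::int)" using ex_pdeg_eq_Gcd[of p] gcd by auto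
  fix k :: 'n
  define q where "q = int (p $ k)"
  have q: "q > 0" using p by (simp add: q_def)
  \<comment> \<open>Entries reduced modulo \<open>q\<close> stay below \<open>q\<close>, so all
    indices except \<open>k\<close> contribute at most \<open>B\<close>; for
    \<open>t \<ge> B\<close> what remains for entry \<open>k\<close> is nonnegative.\<close>
  define B where "B = (\<Sum>i\<in>UNIV - {k}. q * int (p $ i))"
  have "representable p t" if t: "t \<ge> B" for t
  proof -
    text \<open>Reduce the entries other than the \<open>k\<close>-th modulo \<open>p\<^sub>k\<close>, compensating in the \<open>k\<close>-th.\<close>
    define s where "s = (\<Sum>i\<in>UNIV - {k}. (t * y $ i) div q * int (p $ i))"
    define z where "z = (\<chi> i. if i = k then t * y $ k + s else (t * y $ i) mod q)"
    have split: "pdeg p v = v $ k * q + (\<Sum>i\<in>UNIV - {k}. v $ i * int (p $ i))" for v :: "(int, 'n) vec"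
      by (simp add: pdeg_def q_def sum.remove[of UNIV k])
    have "(\<Sum>i\<in>UNIV - {k}. z $ i * int (p $ i)) =
      (\<Sum>i\<in>UNIV - {k}. t * (y $ i * int (p $ i)) - q * ((t * y $ i) div q * int (p $ i)))"
      by (intro sum.cong) (auto simp: z_def minus_div_mult_eq_mod[symmetric] algebra_simps)
    also have "\<dots> = t * (\<Sum>i\<in>UNIV - {k}. y $ i * int (p $ i)) - q * s"
      by (simp add: sum_subtractf s_def sum_distrib_left)
    finally have "pdeg p z = t * pdeg p y"
      unfolding split by (simp add: z_def algebra_simps)
    then have zt: "pdeg p z = t" by (simp add: y)
    have "(\<Sum>i\<in>UNIV - {k}. z $ i * int (p $ i)) \<le> B"
      unfolding B_def using q
      by (intro sum_mono mult_right_mono) (auto simp: z_def less_imp_le)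
    with zt t have "z $ k * q \<ge> 0" unfolding split by linarith
    then have "z $ k \<ge> 0" using q by (simp add: zero_le_mult_iff)
    then have "z $ i \<ge> 0" for i
      using q by (cases "i = k") (auto simp: z_def)
    then show ?thesis using representableI[of z p] zt by simp
  qed
  then show ?thesis by blast
qed

lemma frobenius_number_greatest:
  assumes p: "\<And>i. p $ i > 0" and gcd: "Gcd (range (\<lambda>i. p $ i)) = 1"
  shows "\<not> representable p (frobenius_number p)"
    and "\<And>t. \<not> representable p t \<Longrightarrow> t \<le> frobenius_number p"
proof -
  obtain B where B: "\<And>t. t \<ge> B \<Longrightarrow> representable p t"
    using eventually_representable[OF assms] by blast
  \<comment> \<open>The cutoff makes the set finite, and -1 itself keeps it nonempty; smaller
    integers cannot affect the maximum.\<close>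
  define A where "A = {t. \<not> representable p t \<and> -1 \<le> t}"
  have "t \<le> B" if "t \<in> A" for t
    using that B[of t] by (cases "t \<le> B") (simp_all add: A_def)
  then have "A \<subseteq> {-1..B}" by (auto simp: A_def)
  then have fin: "finite A" by (rule finite_subset) simp
  have neg: "-1 \<in> A" by (auto simp: A_def representable_def)
  have "Max A \<in> A" using fin neg by (intro Max_in) auto
  moreover have le: "t \<le> Max A" if "\<not> representable p t" for t
  proof (cases "-1 \<le> t")
    case False
    then show ?thesis using Max_ge[OF fin neg] by linarith
  qed (use that fin in \<open>simp add: A_def\<close>)
  ultimately have "frobenius_number p = Max A"
    unfolding frobenius_number_def by (intro Greatest_equality) (auto simp: A_def)
  with \<open>Max A \<in> A\<close> le show "\<not> representable p (frobenius_number p)"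
    "\<And>t. \<not> representable p t \<Longrightarrow> t \<le> frobenius_number p"
    by (auto simp: A_def)
qed

section \<open>First entries in the term order, and the set \<open>M_set p G\<close>\<close>

lemma term_less_if_first_entry:
  fixes u :: "(nat, 'n::{finite,linorder}) vec"
  assumes "pdeg p u = pdeg p v" "u $ Min UNIV > v $ Min UNIV"
  shows "term_less p u v"
proof -
  have "\<not> j < Min UNIV" for j :: 'n by (rule leD[OF Min_le]) simp_all
  then show ?thesis using assms unfolding term_less_def by blast
qed

text \<open>Adding the first basis vector to a representation of the smaller number gives a vector
  of the degree of \<open>m\<close> with positive first entry, which precedes
  \<open>m\<close>.\<close>

lemma not_term_least_if_representable:
  fixes p :: "(nat, 'n::{finite,linorder}) vec"
  assumes "representable p (int (pdeg p m) - int (p $ Min UNIV))" and "m $ Min UNIV = 0"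
  shows "\<exists>u. pdeg p u = pdeg p m \<and> term_less p u m"
proof -
  obtain v where v: "int (pdeg p m) - int (p $ Min UNIV) = int (pdeg p v)"
    using assms(1) by (auto simp: representable_def)
  have "pdeg p (v + axis (Min UNIV) 1) = pdeg p m"
    using v by (simp add: pdeg_add pdeg_axis del: One_nat_def)
  moreover have "(v + axis (Min UNIV) 1) $ Min UNIV > m $ Min UNIV"
    using assms(2) by simp
  ultimately show ?thesis using term_less_if_first_entry by blast
qed

text \<open>Nonemptiness is stated explicitly because \<open>Max\<close> is meaningful only on
  finite nonempty sets.\<close>

theorem proposition5:
  fixes p :: "(nat, 'n::{finite,linorder}) vec"
    and G :: "((nat, 'n) vec \<Rightarrow>\<^sub>0 'k::field) set"
  assumes "\<And>i. p $ i > 0"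
    and "Gcd (range (\<lambda>i. p $ i)) = 1"
    and "is_groebner_basis p G (lattice_ideal p)"
  shows "finite (M_set p G)
    \<and> (\<forall>a\<in>M_set p G. \<not> representable p (pdeg p a))
    \<and> M_set p G \<noteq> {}
    \<and> frobenius_number p = Max (pdeg p ` M_set p G)"
proof -
  let ?o = "Min UNIV :: 'n" and ?f = "frobenius_number p"
  note reducible_iff = groebner_reducible_iff[OF assms(1,3)]
  note frob = frobenius_number_greatest[OF assms(1,2)]
  \<comment> \<open>The only negative entry is the first, equal to -1, so taking the positive part
    adds the first basis vector. This gives both the degree shift by \<open>p $ ?o\<close> and the
    injectivity of \<open>pos_part\<close> on \<open>M_set p G\<close>.\<close>
  have pos_part_M: "a + axis ?o 1 = (\<chi> i. int (pos_part a $ i))" if "a \<in> M_set p G" for a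
    using that by (auto simp: M_set_def vec_eq_iff pos_part_def axis_def)
  have deg_M: "int (pdeg p (pos_part a)) = pdeg p a + int (p $ ?o)" if "a \<in> M_set p G" for a
  proof -
    have "int (pdeg p (pos_part a)) = pdeg p (a + axis ?o 1)"
      unfolding pos_part_M[OF that] by (rule of_nat_pdeg)
    then show ?thesis by (simp add: pdeg_add pdeg_axis)
  qed
  have not_repr: "\<not> representable p (pdeg p a)" if a: "a \<in> M_set p G" for a
  proof
    assume "representable p (pdeg p a)"
    moreover have "pos_part a $ ?o = 0" using a by (simp add: M_set_def pos_part_def)
    ultimately have "\<exists>u. pdeg p u = pdeg p (pos_part a) \<and> term_less p u (pos_part a)"
      by (intro not_term_least_if_representable) (simp_all add: deg_M[OF a])
    with a show False using reducible_iff by (auto simp: M_set_def)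
  qed
  have "pos_part ` M_set p G \<subseteq> {v. pdeg p v \<le> nat (?f + int (p $ ?o))}"
  proof (clarsimp)
    fix a assume "a \<in> M_set p G"
    then have "int (pdeg p (pos_part a)) \<le> ?f + int (p $ ?o)"
      using deg_M not_repr frob(2) by fastforce
    then show "pdeg p (pos_part a) \<le> nat (?f + int (p $ ?o))" by linarith
  qed
  then have "finite (pos_part ` M_set p G)"
    using finite_pdeg_le[OF assms(1)] by (rule finite_subset)
  moreover have "inj_on pos_part (M_set p G)"
    using pos_part_M by (intro inj_onI) (metis add_right_cancel)
  ultimately have fin: "finite (M_set p G)" by (rule finite_imageD)
  have "\<exists>c\<in>M_set p G. pdeg p c = ?f"
  proof -
    have repr: "\<exists>v. int (pdeg p v) = ?f + int (p $ i)" for i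
    proof -
      have "representable p (?f + int (p $ i))"
        using frob(2)[of "?f + int (p $ i)"] assms(1)[of i] by force
      then show ?thesis unfolding representable_def by metis
    qed
    \<comment> \<open>The term-least vector \<open>m\<close> of this degree is irreducible; lowering
      its first entry by 1 produces the witness \<open>c\<close> of degree
      \<open>?f\<close>.\<close>
    define A where "A = {v. int (pdeg p v) = ?f + int (p $ ?o)}"
    have "finite A"
      by (rule finite_subset[OF _ finite_pdeg_eq[OF assms(1), where d = "nat (?f + int (p $ ?o))"]])
        (auto simp: A_def)
    moreover have "A \<noteq> {}" using repr by (auto simp: A_def)
    ultimately obtain m where m: "m \<in> A" "\<And>v. v \<in> A \<Longrightarrow> v \<noteq> m \<Longrightarrow> term_less p m v"
      using ex_term_least[of A p] by blast
    have least: "\<not> (\<exists>u. pdeg p u = pdeg p m \<and> term_less p u m)"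
      using m by (auto simp: A_def) (metis term_less_irrefl term_less_trans)
    define c :: "(int, 'n) vec" where "c = (\<chi> i. int (m $ i)) - axis ?o 1"
    have deg_c: "pdeg p c = ?f"
    proof -
      have "pdeg p c + pdeg p (axis ?o 1) = pdeg p (\<chi> i. int (m $ i))"
        by (simp add: c_def flip: pdeg_add)
      then show ?thesis using m(1) by (simp add: A_def pdeg_axis of_nat_pdeg)
    qed
    \<comment> \<open>Otherwise \<open>c\<close> would be nonnegative and represent the Frobenius
      number.\<close>
    have m0: "m $ ?o = 0"
    proof (rule ccontr)
      assume "m $ ?o \<noteq> 0"
      then have "c $ i \<ge> 0" for i by (simp add: c_def axis_def)
      then show False using representableI[of c p] deg_c frob(1) by simp
    qed
    have pos_c: "pos_part c = m"
      using m0 by (auto simp: vec_eq_iff pos_part_def c_def axis_def)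
    have pos_c': "pos_part (c + axis i 1) = m + axis i 1" if "i \<noteq> ?o" for i
      using m0 that by (auto simp: vec_eq_iff pos_part_def c_def axis_def)
    have "\<exists>g\<in>G. reducible_by p (pos_part (c + axis i 1)) g" if i: "i \<noteq> ?o" for i
    proof -
      obtain v where "int (pdeg p v) = ?f + int (p $ i)" using repr by blast
      \<comment> \<open>The degree of \<open>m + axis i 1\<close> less \<open>p $ ?o\<close> is
        \<open>?f + p $ i\<close>, which exceeds the Frobenius number and so is represented by
        \<open>v\<close>.\<close>
      then have "representable p (int (pdeg p (m + axis i 1)) - int (p $ ?o))"
        using m(1) by (auto simp: representable_def A_def pdeg_add pdeg_axis simp del: One_nat_def intro!: exI[of _ v])
      moreover have "(m + axis i 1) $ ?o = 0" using m0 i by (simp add: axis_def)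
      ultimately show ?thesis
        unfolding pos_c'[OF i] reducible_iff by (rule not_term_least_if_representable)
    qed
    moreover have "\<not> (\<exists>g\<in>G. reducible_by p (pos_part c) g)"
      using least unfolding pos_c reducible_iff .
    moreover have "c $ ?o = -1" "\<forall>i. i \<noteq> ?o \<longrightarrow> c $ i \<ge> 0"
      using m0 by (auto simp: c_def axis_def)
    ultimately have "c \<in> M_set p G" by (simp add: M_set_def)
    with deg_c show ?thesis by blast
  qed
  then obtain c where c: "c \<in> M_set p G" "pdeg p c = ?f" by blast
  have "Max (pdeg p ` M_set p G) = ?f"
    using fin c(1) not_repr frob(2) by (intro Max_eqI) (auto simp flip: c(2))
  with fin not_repr c(1) show ?thesis by auto
qed

end
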